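(* Let $q$ be an integer and let $G$ be a finite simple undirected graph that is $K_q$-free. Then the algorithm $\mathrm{EIS}$ enumerates all independent sets of $G$ in $O(q)$ amortized time, even if the exact value of $q$ is unknown.
   Context: A graph is $K_q$-free if it has no clique with $q$ vertices. The enumeration problem: given $G$, output all independent sets of $G$ (including the empty set) without duplication. An enumeration algorithm runs in $O(f)$ amortized time if its total running time is $O(f\cdot M)$, where $M$ is the number of solutions, i.e. $O(f)$ time per solution on average. The input graph is stored as an adjacency matrix. Algorithm $\mathrm{EIS}(G)$, whose only input is $G$, calls $\mathrm{RecEIS}(G,\emptyset)$. The procedure $\mathrm{RecEIS}(G,S)$ outputs $S$; then, while $G$ has a vertex, it picks a vertex $v$ of minimum degree in the current graph $G$ (ties broken by a fixed deterministic rule), calls $\mathrm{RecEIS}(G\setminus N[v],\,S\cup\{v\})$, and then replaces $G$ by $G\setminus\{v\}$. Here $N[v]$ is the closed neighborhood of $v$ in the current graph, and $G\setminus U$ is the subgraph induced by $V(G)\setminus U$. *)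

theory Defs
  imports Main
begin

section \<open>Graphs\<close>

definition simple_graph :: "'a set \<Rightarrow> 'a set set \<Rightarrow> bool" where
  "simple_graph V E \<longleftrightarrow> finite V \<and> (\<forall>e\<in>E. e \<subseteq> V \<and> card e = 2)"

definition clique :: "'a set \<Rightarrow> 'a set set \<Rightarrow> 'a set \<Rightarrow> bool" where
  "clique V E K \<longleftrightarrow> K \<subseteq> V \<and> (\<forall>u\<in>K. \<forall>v\<in>K. u \<noteq> v \<longrightarrow> {u, v} \<in> E)"

text \<open>No graph is clique-free for q = 0 (the empty set is a clique), and only the graph without
  vertices is for q = 1.\<close>

definition clique_free :: "nat \<Rightarrow> 'a set \<Rightarrow> 'a set set \<Rightarrow> bool" where
  "clique_free q V E \<longleftrightarrow> \<not> (\<exists>K. clique V E K \<and> card K = q)"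

definition independent_set :: "'a set \<Rightarrow> 'a set set \<Rightarrow> 'a set \<Rightarrow> bool" where
  "independent_set V E S \<longleftrightarrow> S \<subseteq> V \<and> (\<forall>u\<in>S. \<forall>v\<in>S. {u, v} \<notin> E)"

definition independent_sets :: "'a set \<Rightarrow> 'a set set \<Rightarrow> 'a set set" where
  "independent_sets V E = {S. independent_set V E S}"

type_synonym matrix = "nat \<Rightarrow> nat \<Rightarrow> bool"

definition adjacency_matrix :: "nat set set \<Rightarrow> matrix" where
  "adjacency_matrix E = (\<lambda>i j. {i, j} \<in> E)"

section \<open>Computations with output and running time\<close>

text \<open>A computation delivers a result, the stream of items output on the way, and the number of
  steps taken. Below, every clause of every function is charged one step (or more) and does, apart
  from calls that are themselves charged, only a bounded number of unit-cost operations: reading a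
  matrix entry, comparing or incrementing numbers, building or taking apart a list cell, passing a
  reference to a list.\<close>

datatype ('a, 'o) comp = Comp (result: 'a) (outputs: "'o list") (steps: nat)

definition return :: "'a \<Rightarrow> ('a, 'o) comp" where
  "return x = Comp x [] 1"

definition bind :: "('a, 'o) comp \<Rightarrow> ('a \<Rightarrow> ('b, 'o) comp) \<Rightarrow> ('b, 'o) comp"  (infixl \<open>\<bind>\<close> 54) where
  "m \<bind> f =
     (let m' = f (result m)
      in Comp (result m') (outputs m @ outputs m') (steps m + steps m'))"

text \<open>Emitting an item costs one step: the solutions are lists that share their tails, and it is a
  reference to such a list that is emitted. (Printing every solution element by element takes, for
  an edgeless graph, time proportional to the number of vertices on average, whatever the
  algorithm.)\<close>

definition emit :: "'o \<Rightarrow> (unit, 'o) comp" where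
  "emit x = Comp () [x] 1"

lemma bind_cong [fundef_cong]:
  assumes "m = m'" and "\<And>x. x = result m' \<Longrightarrow> f x = g x"
  shows "m \<bind> f = m' \<bind> g"
  using assms by (simp add: bind_def)

lemma result_return [simp]: "result (return x) = x"
  by (simp add: return_def)

lemma result_bind [simp]: "result (m \<bind> f) = result (f (result m))"
  by (simp add: bind_def Let_def)

section \<open>The algorithm\<close>

text \<open>The current graph is always an induced subgraph of the input graph. It is stored as the list
  of its vertices, each paired with its degree in the current graph; edges are looked up in the
  matrix of the input graph.\<close>

fun degree_in :: "matrix \<Rightarrow> nat \<Rightarrow> nat list \<Rightarrow> (nat, 'o) comp" where
  "degree_in A v [] = return 0"
| "degree_in A v (u # us) =
     degree_in A v us \<bind> (\<lambda>d. return (if A v u then d + 1 else d))"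

fun with_degrees :: "matrix \<Rightarrow> nat list \<Rightarrow> nat list \<Rightarrow> ((nat \<times> nat) list, 'o) comp" where
  "with_degrees A us [] = return []"
| "with_degrees A us (v # vs) =
     degree_in A v us \<bind> (\<lambda>d.
     with_degrees A us vs \<bind> (\<lambda>G.
     return ((v, d) # G)))"

text \<open>The tie-breaking rule is a parameter: given the matrix and the current graph, it
  decides in one step whether x is to be preferred to y for two vertices x, y of equal degree. Any
  rule whatsoever that selects, for each current graph, some vertex w of minimum degree is an
  instance: prefer x to y iff x = w.\<close>

type_synonym tie_rule = "matrix \<Rightarrow> (nat \<times> nat) list \<Rightarrow> nat \<Rightarrow> nat \<Rightarrow> bool"

text \<open>One pass through a vertex list, with (v, d) the best vertex seen so far and its degree.\<close>

fun min_degree_vertex :: "(nat \<Rightarrow> nat \<Rightarrow> bool) \<Rightarrow> nat \<times> nat \<Rightarrow> (nat \<times> nat) list \<Rightarrow> (nat, 'o) comp" where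
  "min_degree_vertex better (v, d) [] = return v"
| "min_degree_vertex better (v, d) ((u, k) # G) =
     return (if k < d \<or> (k = d \<and> better u v) then (u, k) else (v, d)) \<bind> (\<lambda>best.
     min_degree_vertex better best G)"

text \<open>The vertices of the current graph outside the closed neighbourhood of v.\<close>

fun outside_nbhd :: "matrix \<Rightarrow> nat \<Rightarrow> (nat \<times> nat) list \<Rightarrow> (nat list, 'o) comp" where
  "outside_nbhd A v [] = return []"
| "outside_nbhd A v ((u, k) # G) =
     outside_nbhd A v G \<bind> (\<lambda>us. return (if u = v \<or> A v u then us else u # us))"

fun delete_vertex :: "matrix \<Rightarrow> nat \<Rightarrow> (nat \<times> nat) list \<Rightarrow> ((nat \<times> nat) list, 'o) comp" where
  "delete_vertex A v [] = return []"
| "delete_vertex A v ((u, k) # G) =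
     delete_vertex A v G \<bind> (\<lambda>H.
     return (if u = v then H else (u, if A v u then k - 1 else k) # H))"

lemma length_with_degrees: "length (result (with_degrees A us vs)) = length vs"
  by (induction vs) auto

lemma min_degree_vertex_mem:
  "result (min_degree_vertex better b G) \<in> fst ` set (b # G)"
  by (induction better b G rule: min_degree_vertex.induct) (auto split: if_splits)

lemma length_outside_nbhd_le: "length (result (outside_nbhd A v G)) \<le> length G"
  by (induction A v G rule: outside_nbhd.induct) auto

lemma length_outside_nbhd:
  "v \<in> fst ` set G \<Longrightarrow> length (result (outside_nbhd A v G)) < length G"
  by (induction A v G rule: outside_nbhd.induct)
     (auto simp: less_Suc_eq_le Suc_le_eq length_outside_nbhd_le rev_image_eqI)

lemma length_delete_vertex_le: "length (result (delete_vertex A v G)) \<le> length G"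
  by (induction A v G rule: delete_vertex.induct) auto

lemma length_delete_vertex:
  "v \<in> fst ` set G \<Longrightarrow> length (result (delete_vertex A v G)) < length G"
  by (induction A v G rule: delete_vertex.induct)
     (auto simp: less_Suc_eq_le Suc_le_eq length_delete_vertex_le rev_image_eqI)

text \<open>A solution is emitted as the list of its vertices. \<open>RecEIS_loop\<close> is the while loop of
  \<open>RecEIS\<close>. Degrees are computed once per call of \<open>RecEIS\<close> and updated as vertices are deleted.\<close>

function (sequential)
    RecEIS :: "tie_rule \<Rightarrow> matrix \<Rightarrow> nat list \<Rightarrow> nat list \<Rightarrow> (unit, nat list) comp"
and RecEIS_loop :: "tie_rule \<Rightarrow> matrix \<Rightarrow> (nat \<times> nat) list \<Rightarrow> nat list \<Rightarrow> (unit, nat list) comp"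
where
  "RecEIS tie A vs S =
     emit S \<bind> (\<lambda>_.
     with_degrees A vs vs \<bind> (\<lambda>G.
     RecEIS_loop tie A G S))"
| "RecEIS_loop tie A [] S = return ()"
| "RecEIS_loop tie A (x # G) S =
     min_degree_vertex (tie A (x # G)) x G \<bind> (\<lambda>v.
     outside_nbhd A v (x # G) \<bind> (\<lambda>us.
     RecEIS tie A us (v # S) \<bind> (\<lambda>_.
     delete_vertex A v (x # G) \<bind> (\<lambda>H.
     RecEIS_loop tie A H S))))"
  by pat_completeness auto

termination
proof (relation "measure (\<lambda>z. case z of
         Inl (tie, A, vs, S) \<Rightarrow> 2 * length vs + 1
       | Inr (tie, A, G, S) \<Rightarrow> 2 * length G)", goal_cases)
  case 1
  show ?case by simp
next
  case 2
  then show ?case by (simp add: length_with_degrees)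
next
  case (3 tie A x G S v us)
  then have "length us < length (x # G)"
    using length_outside_nbhd min_degree_vertex_mem by metis
  then show ?case by simp
next
  case (4 tie A x G S v us u H)
  then have "length H < length (x # G)"
    using length_delete_vertex min_degree_vertex_mem by metis
  then show ?case by simp
qed

fun vertex_list :: "nat \<Rightarrow> (nat list, 'o) comp" where
  "vertex_list 0 = return []"
| "vertex_list (Suc n) = vertex_list n \<bind> (\<lambda>vs. return (n # vs))"

text \<open>The input is the number n of vertices and the n by n adjacency matrix of a graph on
  {0,...,n-1}.\<close>

definition EIS :: "tie_rule \<Rightarrow> nat \<Rightarrow> matrix \<Rightarrow> (unit, nat list) comp" where
  "EIS tie n A = vertex_list n \<bind> (\<lambda>vs. RecEIS tie A vs [])"

end

theory Submission
  imports Defs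
begin

text \<open>Every call of \<open>RecEIS\<close> emits exactly one solution, and apart from its recursive calls it takes
  \<open>O(n\<^sup>2)\<close> steps on a graph with n vertices. In a graph without a clique of size q a vertex
  of minimum degree has at least \<open>n / q\<close> non-neighbours (itself included), since otherwise
  a clique of size q could be built greedily. Hence the call made when k vertices are left receives at least
  \<open>(k - 1) div q\<close> vertices. This pays for the quadratic cost by the potential method: with the
  linear potential \<open>g n = 16 q (n + 3)\<close>, the steps of a call plus \<open>g n\<close> are at most \<open>51 q\<close> times
  the number of its outputs, because \<open>\<Sum>k<n. g (k div q)\<close> is at least
  \<open>6 n\<^sup>2 + 2 n + g n - O(q)\<close>.\<close>

section \<open>The elementary procedures\<close>

lemma steps_return [simp]: "steps (return x) = 1"
  and outputs_return [simp]: "outputs (return x) = []"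
  by (simp_all add: return_def)

lemma steps_bind [simp]: "steps (m \<bind> f) = steps m + steps (f (result m))"
  and outputs_bind [simp]: "outputs (m \<bind> f) = outputs m @ outputs (f (result m))"
  by (simp_all add: bind_def Let_def)

lemma steps_emit [simp]: "steps (emit x) = 1"
  and outputs_emit [simp]: "outputs (emit x) = [x]"
  by (simp_all add: emit_def)

definition degree :: "matrix \<Rightarrow> nat list \<Rightarrow> nat \<Rightarrow> nat" where
  "degree A us v = length (filter (A v) us)"

text \<open>The loop is only analysed on arguments of this form, where the stored degrees are the
  true ones of the current graph.\<close>

definition degree_list :: "matrix \<Rightarrow> nat list \<Rightarrow> (nat \<times> nat) list" where
  "degree_list A us = map (\<lambda>v. (v, degree A us v)) us"

lemma degree_in_simps [simp]:
  "result (degree_in A v us) = degree A us v"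
  "outputs (degree_in A v us) = []"
  "steps (degree_in A v us) = length us + 1"
  by (induction us) (auto simp: degree_def)

lemma with_degrees_simps [simp]:
  "result (with_degrees A us vs) = map (\<lambda>v. (v, degree A us v)) vs"
  "outputs (with_degrees A us vs) = []"
  "steps (with_degrees A us vs) = length vs * (length us + 2) + 1"
  by (induction vs) auto

lemma min_degree_vertex_simps [simp]:
  "outputs (min_degree_vertex better b G) = []"
  "steps (min_degree_vertex better b G) = length G + 1"
  by (induction better b G rule: min_degree_vertex.induct) auto

text \<open>The degree \<open>k\<close> is existential because only the vertex is returned. Nothing
  is assumed about \<open>better\<close>, so every tie-breaking rule is covered.\<close>

lemma min_degree_vertex_minimal:
  "\<exists>k. (result (min_degree_vertex better b G :: (nat, 'o) comp), k) \<in> set (b # G) \<and> (\<forall>(u, j) \<in> set (b # G). k \<le> j)"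
proof (induction G arbitrary: b)
  case Nil
  then show ?case by (cases b) auto
next
  case (Cons x G)
  obtain v d u k where b: "b = (v, d)" and x: "x = (u, k)"
    by (cases b, cases x)
  define b' where "b' = (if k < d \<or> (k = d \<and> better u v) then (u, k) else (v, d))"
  obtain l where "(result (min_degree_vertex better b' G :: (nat, 'o) comp), l) \<in> set (b' # G)"
      "\<forall>(w, j) \<in> set (b' # G). l \<le> j"
    using Cons.IH[of b'] by blast
  moreover have "snd b' \<le> d" "snd b' \<le> k" "b' = (u, k) \<or> b' = (v, d)"
    by (auto simp: b'_def)
  moreover have "result (min_degree_vertex better b (x # G) :: (nat, 'o) comp) =
      result (min_degree_vertex better b' G :: (nat, 'o) comp)"
    by (simp add: b x b'_def)
  ultimately show ?case
    by (intro exI[of _ l]) (fastforce simp: b x)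
qed

lemma outside_nbhd_simps [simp]:
  "result (outside_nbhd A v G) = filter (\<lambda>u. u \<noteq> v \<and> \<not> A v u) (map fst G)"
  "outputs (outside_nbhd A v G) = []"
  "steps (outside_nbhd A v G) = length G + 1"
  by (induction A v G rule: outside_nbhd.induct) auto

lemma delete_vertex_simps [simp]:
  "outputs (delete_vertex A v G) = []"
  "steps (delete_vertex A v G) = length G + 1"
  by (induction A v G rule: delete_vertex.induct) auto

lemma degree_filter_neq:
  assumes "distinct us" "v \<in> set us"
  shows "degree A (filter (\<lambda>w. w \<noteq> v) us) u = (if A u v then degree A us u - 1 else degree A us u)"
proof -
  have "degree A us u = card {w \<in> set us. A u w}"
    using assms by (simp add: degree_def distinct_length_filter Collect_conj_eq Int_commute)
  moreover have "degree A (filter (\<lambda>w. w \<noteq> v) us) u = card ({w \<in> set us. A u w} - {v})"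
    using assms by (simp add: degree_def flip: distinct_card)
      (rule arg_cong[where f = card], auto)
  ultimately show ?thesis
    using assms by (simp add: card_Diff_singleton_if)
qed

text \<open>The form \<open>degree_list\<close> survives an iteration. Symmetry is needed because
  the update tests \<open>A v u\<close>, while the degree of \<open>u\<close> counts entries
  \<open>A u v\<close>.\<close>

lemma result_delete_vertex:
  assumes sym: "\<And>u. A v u = A u v" and "distinct us" "v \<in> set us"
  shows "result (delete_vertex A v (degree_list A us)) = degree_list A (filter (\<lambda>w. w \<noteq> v) us)"
proof -
  \<comment> \<open>For the induction, the traversed list \<open>ws\<close> is separated from the
    list \<open>us\<close> in which degrees are taken.\<close>
  have "result (delete_vertex A v (map (\<lambda>u. (u, degree A us u)) ws)) =
      map (\<lambda>u. (u, degree A (filter (\<lambda>w. w \<noteq> v) us) u)) (filter (\<lambda>w. w \<noteq> v) ws)" for ws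
    by (induction ws) (auto simp: sym degree_filter_neq[OF assms(2,3)])
  then show ?thesis
    by (simp add: degree_list_def)
qed

lemma vertex_list_simps [simp]:
  "result (vertex_list n) = rev [0..<n]"
  "outputs (vertex_list n) = []"
  "steps (vertex_list n) = n + 1"
  by (induction n) auto

section \<open>Unfolding the recursion\<close>

lemma RecEIS_unfold:
  "outputs (RecEIS tie A vs S) = S # outputs (RecEIS_loop tie A (degree_list A vs) S)"
  "steps (RecEIS tie A vs S) =
     2 + length vs * (length vs + 2) + steps (RecEIS_loop tie A (degree_list A vs) S)"
  by (simp_all add: degree_list_def)

declare RecEIS.simps [simp del]

lemma RecEIS_loop_Nil [simp]:
  "outputs (RecEIS_loop tie A (degree_list A []) S) = []"
  "steps (RecEIS_loop tie A (degree_list A []) S) = 1"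
  by (simp_all add: degree_list_def)

text \<open>One iteration of the loop. Of the selected vertex only membership and minimality of its
  degree are kept; the cost \<open>3 * length vs + 2\<close> is that of selection, filtering and
  deletion.\<close>

lemma RecEIS_loop_unfold:
  assumes sym: "\<And>u v. A u v = A v u" and "distinct vs" "vs \<noteq> []"
  obtains v where "v \<in> set vs" "\<And>u. u \<in> set vs \<Longrightarrow> degree A vs v \<le> degree A vs u"
    "outputs (RecEIS_loop tie A (degree_list A vs) S) =
       outputs (RecEIS tie A (filter (\<lambda>u. u \<noteq> v \<and> \<not> A v u) vs) (v # S)) @
       outputs (RecEIS_loop tie A (degree_list A (filter (\<lambda>u. u \<noteq> v) vs)) S)"
    "steps (RecEIS_loop tie A (degree_list A vs) S) =
       3 * length vs + 2 +
       steps (RecEIS tie A (filter (\<lambda>u. u \<noteq> v \<and> \<not> A v u) vs) (v # S)) +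
       steps (RecEIS_loop tie A (degree_list A (filter (\<lambda>u. u \<noteq> v) vs)) S)"
proof -
  obtain x G where xG: "degree_list A vs = x # G"
    using \<open>vs \<noteq> []\<close> by (cases vs) (auto simp: degree_list_def)
  define v where "v = result (min_degree_vertex (tie A (x # G)) x G :: (nat, nat list) comp)"
  obtain k where k: "(v, k) \<in> set (degree_list A vs)" "\<forall>(u, j) \<in> set (degree_list A vs). k \<le> j"
    unfolding v_def xG using min_degree_vertex_minimal by blast
  have v: "v \<in> set vs" and "k = degree A vs v"
    using k(1) by (auto simp: degree_list_def)
  have min: "degree A vs v \<le> degree A vs u" if "u \<in> set vs" for u
    using k(2) that \<open>k = _\<close> by (auto simp: degree_list_def)
  have fst: "map fst (x # G) = vs"
    by (simp flip: xG) (simp add: degree_list_def o_def)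
  have len: "length vs = Suc (length G)"
    using arg_cong[OF fst, of length] by simp
  have del: "result (delete_vertex A v (x # G)) = degree_list A (filter (\<lambda>u. u \<noteq> v) vs)"
    unfolding xG[symmetric] using sym assms(2) v by (rule result_delete_vertex)
  note unfold = RecEIS_loop.simps(2)[of tie A x G S, folded xG]
  have "outputs (RecEIS_loop tie A (degree_list A vs) S) =
       outputs (RecEIS tie A (filter (\<lambda>u. u \<noteq> v \<and> \<not> A v u) vs) (v # S)) @
       outputs (RecEIS_loop tie A (degree_list A (filter (\<lambda>u. u \<noteq> v) vs)) S)"
    by (simp add: unfold fst[folded xG] del[folded xG] v_def[folded xG, symmetric])
  moreover have "steps (RecEIS_loop tie A (degree_list A vs) S) =
       3 * length vs + 2 +
       steps (RecEIS tie A (filter (\<lambda>u. u \<noteq> v \<and> \<not> A v u) vs) (v # S)) +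
       steps (RecEIS_loop tie A (degree_list A (filter (\<lambda>u. u \<noteq> v) vs)) S)"
    by (simp add: unfold fst[folded xG] del[folded xG] v_def[folded xG, symmetric])
       (simp add: xG len)
  ultimately show thesis
    using v min by (rule that[rotated 2])
qed

section \<open>Correctness\<close>

text \<open>Sets containing \<open>v\<close> correspond to independent sets avoiding its closed
  neighbourhood. \<open>E\<close> can stay unrestricted, since independence only concerns pairs
  inside the set.\<close>

lemma independent_sets_split:
  assumes "v \<in> V" "{v} \<notin> E"
  shows "independent_sets V E =
    insert v ` independent_sets {u \<in> V. u \<noteq> v \<and> {v, u} \<notin> E} E \<union> independent_sets (V - {v}) E"
    (is "_ = insert v ` ?N \<union> ?D")
proof (intro equalityI subsetI)
  fix I assume I: "I \<in> independent_sets V E"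
  show "I \<in> insert v ` ?N \<union> ?D"
  proof (cases "v \<in> I")
    case True
    then have "I - {v} \<in> ?N"
      using I by (auto simp: independent_sets_def independent_set_def)
    moreover have "I = insert v (I - {v})"
      using True by blast
    ultimately show ?thesis
      by (intro UnI1 image_eqI)
  next
    case False
    then show ?thesis
      using I by (auto simp: independent_sets_def independent_set_def)
  qed
qed (use assms in \<open>auto simp: independent_sets_def independent_set_def insert_commute\<close>)

text \<open>Outputs are compared as sets, so the same solution in another order would count as a
  duplicate. \<open>X\<close> holds the extensions of the prefix \<open>S\<close>.\<close>

definition enumerates :: "nat list list \<Rightarrow> nat list \<Rightarrow> nat set set \<Rightarrow> bool" where
  "enumerates out S X \<longleftrightarrow>
     distinct (map set out) \<and> set (map set out) = (\<lambda>I. set S \<union> I) ` X"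

text \<open>The emitted \<open>S\<close> is the extension by the empty set, so the loop is left with
  the nonempty ones. Disjointness keeps these from yielding \<open>S\<close> again.\<close>

lemma RecEIS_enumerates_if_loop:
  assumes "enumerates (outputs (RecEIS_loop tie A (degree_list A vs) S)) S
             (independent_sets (set vs) E - {{}})"
    and "set S \<inter> set vs = {}"
  shows "enumerates (outputs (RecEIS tie A vs S)) S (independent_sets (set vs) E)"
proof -
  have "{} \<in> independent_sets (set vs) E"
    by (simp add: independent_sets_def independent_set_def)
  then have "independent_sets (set vs) E = insert {} (independent_sets (set vs) E - {{}})"
    by blast
  moreover have "set S \<notin> (\<lambda>I. set S \<union> I) ` (independent_sets (set vs) E - {{}})"
    using assms(2) by (fastforce simp: independent_sets_def independent_set_def)
  ultimately show ?thesis
    using assms(1) unfolding enumerates_def RecEIS_unfold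
    by (metis (no_types, lifting) Un_empty_right distinct.simps(2) image_insert list.map(2) list.set(2))
qed

lemma RecEIS_loop_enumerates:
  assumes irrefl: "\<And>v. {v} \<notin> E" and A: "A = adjacency_matrix E"
  shows "distinct vs \<Longrightarrow> set S \<inter> set vs = {} \<Longrightarrow>
    enumerates (outputs (RecEIS_loop tie A (degree_list A vs) S)) S (independent_sets (set vs) E - {{}})"
proof (induction "length vs" arbitrary: vs S rule: less_induct)
  case less
  show ?case
  proof (cases "vs = []")
    case True
    then show ?thesis
      by (auto simp: enumerates_def independent_sets_def independent_set_def)
  next
    case False
    have sym: "A u v = A v u" for u v
      by (simp add: A adjacency_matrix_def insert_commute)
    obtain v where v: "v \<in> set vs" and out:
      "outputs (RecEIS_loop tie A (degree_list A vs) S) =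
       outputs (RecEIS tie A (filter (\<lambda>u. u \<noteq> v \<and> \<not> A v u) vs) (v # S)) @
       outputs (RecEIS_loop tie A (degree_list A (filter (\<lambda>u. u \<noteq> v) vs)) S)"
      by (rule RecEIS_loop_unfold[OF sym less.prems(1) False, where tie = tie and S = S]) (rule that)
    define N where "N = filter (\<lambda>u. u \<noteq> v \<and> \<not> A v u) vs"
    define D where "D = filter (\<lambda>u. u \<noteq> v) vs"
    have setN: "set N = {u \<in> set vs. u \<noteq> v \<and> {v, u} \<notin> E}"
      by (auto simp: N_def A adjacency_matrix_def)
    have setD: "set D = set vs - {v}"
      by (auto simp: D_def)
    have lengths: "length N < length vs" "length D < length vs"
      unfolding N_def D_def using v by (auto intro!: length_filter_less)
    have "enumerates (outputs (RecEIS tie A N (v # S))) (v # S) (independent_sets (set N) E)"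
      using less.prems
      by (intro RecEIS_enumerates_if_loop less.hyps lengths) (auto simp: N_def)
    \<comment> \<open>Here \<open>v\<close> moves from the prefix \<open>v # S\<close> into the
      extensions.\<close>
    then have N: "distinct (map set (outputs (RecEIS tie A N (v # S))))"
        "set (map set (outputs (RecEIS tie A N (v # S)))) =
          (\<lambda>I. set S \<union> I) ` insert v ` independent_sets (set N) E"
      by (auto simp: enumerates_def image_image)
    have D: "distinct (map set (outputs (RecEIS_loop tie A (degree_list A D) S)))"
        "set (map set (outputs (RecEIS_loop tie A (degree_list A D) S))) =
          (\<lambda>I. set S \<union> I) ` (independent_sets (set D) E - {{}})"
      using less.hyps[OF lengths(2), of S] less.prems by (auto simp: enumerates_def D_def)
    have split: "independent_sets (set vs) E - {{}} =
        insert v ` independent_sets (set N) E \<union> (independent_sets (set D) E - {{}})"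
      unfolding independent_sets_split[OF v irrefl] setN setD by blast
    \<comment> \<open>The two output families are disjoint because exactly the sets of the first
      contain \<open>v\<close>.\<close>
    have "v \<notin> set S"
      using v less.prems by blast
    then have "(\<lambda>I. set S \<union> I) ` insert v ` independent_sets (set N) E \<inter>
        (\<lambda>I. set S \<union> I) ` (independent_sets (set D) E - {{}}) = {}"
      by (auto simp: independent_sets_def independent_set_def setD)
    then show ?thesis
      unfolding enumerates_def out split image_Un N_def[symmetric] D_def[symmetric]
        map_append set_append distinct_append N(2) D(2)
      using N(1) D(1) by blast
  qed
qed

section \<open>Running time\<close>

lemma clique_free_subset:
  "clique_free q V E \<Longrightarrow> W \<subseteq> V \<Longrightarrow> clique_free q W E"
  by (auto simp: clique_free_def clique_def)

text \<open>If \<open>card V\<close> exceeded \<open>q * m\<close>, a clique with fewer than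
  \<open>q\<close> vertices could always be extended: its members together rule out at most
  \<open>q * m\<close> vertices.\<close>

lemma card_le_if_clique_free:
  assumes "finite V" "clique_free q V E" and irrefl: "\<And>v. {v} \<notin> E"
    and nonnbrs: "\<And>u. u \<in> V \<Longrightarrow> card {w \<in> V. {u, w} \<notin> E} \<le> m"
  shows "card V \<le> q * m"
proof (rule ccontr)
  assume large: "\<not> card V \<le> q * m"
  have "\<exists>K. clique V E K \<and> card K = j" if "j \<le> q" for j
    using that
  proof (induction j)
    case 0
    show ?case
      by (intro exI[of _ "{}"]) (simp add: clique_def)
  next
    case (Suc j)
    then obtain K where K: "clique V E K" "card K = j"
      by auto
    then have "K \<subseteq> V" "finite K"
      using \<open>finite V\<close> by (auto simp: clique_def intro: finite_subset)
    let ?B = "\<Union>u\<in>K. {w \<in> V. {u, w} \<notin> E}"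
    have "card ?B \<le> (\<Sum>u\<in>K. card {w \<in> V. {u, w} \<notin> E})"
      using \<open>finite K\<close> by (rule card_UN_le)
    also have "\<dots> \<le> j * m"
      using sum_bounded_above[of K "\<lambda>u. card {w \<in> V. {u, w} \<notin> E}" m] nonnbrs \<open>K \<subseteq> V\<close> K(2)
      by auto
    also have "\<dots> \<le> q * m"
      using Suc.prems by simp
    finally have "card ?B \<le> q * m" .
    then have "?B \<noteq> V"
      using large by (intro notI) (simp only:)
    then obtain w where w: "w \<in> V" "w \<notin> ?B"
      by blast
    \<comment> \<open>Each vertex is its own non-neighbour, so \<open>?B\<close> contains
      \<open>K\<close>.\<close>
    have "w \<notin> K"
      using w irrefl[of w] by auto
    then have "clique V E (insert w K)" "card (insert w K) = Suc j"
      using K w \<open>finite K\<close> by (auto simp: clique_def insert_commute)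
    then show ?case
      by blast
  qed
  then show False
    using assms(2) by (auto simp: clique_free_def)
qed

text \<open>Minimum degree means a maximum number of non-neighbours, so this number for
  \<open>v\<close> can serve as \<open>m\<close> in \<open>card_le_if_clique_free\<close>.\<close>

lemma length_outside_nbhd_ge:
  assumes irrefl: "\<And>v. {v} \<notin> E" and A: "A = adjacency_matrix E"
    and "distinct vs" "v \<in> set vs" "clique_free q (set vs) E"
    and min: "\<And>u. u \<in> set vs \<Longrightarrow> degree A vs v \<le> degree A vs u"
  shows "(length vs - 1) div q \<le> length (filter (\<lambda>u. u \<noteq> v \<and> \<not> A v u) vs)"
proof -
  have degree: "card {w \<in> set vs. {u, w} \<notin> E} = length vs - degree A vs u" for u
  proof -
    have "length vs = degree A vs u + length (filter (\<lambda>w. \<not> A u w) vs)"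
      unfolding degree_def by (rule sum_length_filter_compl[symmetric])
    moreover have "length (filter (\<lambda>w. \<not> A u w) vs) = card {w \<in> set vs. {u, w} \<notin> E}"
      using \<open>distinct vs\<close> by (simp add: A adjacency_matrix_def flip: distinct_card)
    ultimately show ?thesis
      by simp
  qed
  define N where "N = filter (\<lambda>u. u \<noteq> v \<and> \<not> A v u) vs"
  have "{w \<in> set vs. {v, w} \<notin> E} = insert v (set N)"
    using assms(4) irrefl by (auto simp: N_def A adjacency_matrix_def)
  moreover have "v \<notin> set N" "distinct N"
    using \<open>distinct vs\<close> by (auto simp: N_def)
  ultimately have N: "card {w \<in> set vs. {v, w} \<notin> E} = Suc (length N)"
    by (simp add: distinct_card)
  have "card (set vs) \<le> q * card {w \<in> set vs. {v, w} \<notin> E}"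
    using card_le_if_clique_free[OF _ assms(5) irrefl] min by (simp add: degree diff_le_mono2)
  then have "length vs \<le> q * Suc (length N)"
    using \<open>distinct vs\<close> N by (simp add: distinct_card)
  moreover have "0 < length vs"
    using assms(4) by auto
  \<comment> \<open>\<open>Suc\<close> accounts for \<open>v\<close> itself; subtracting one on the
    left gives the strict inequality that division needs.\<close>
  ultimately have "length vs - 1 < q * Suc (length N)"
    by linarith
  then have "(length vs - 1) div q < Suc (length N)"
    by (simp add: less_mult_imp_div_less mult.commute)
  then show ?thesis
    by (simp add: N_def)
qed

section \<open>The potential argument\<close>

text \<open>The term \<open>3 + 6 * n\<^sup>2 + 2 * n\<close> is the work of a call outside its
  recursive calls, and \<open>51 * q\<close> is the credit for its own output: \<open>48 * q\<close>
  for the potential at 0 and \<open>3 * q\<close> for the constant 3.\<close>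

lemma potential_bound:
  fixes n q :: nat
  assumes "q > 0"
  shows "3 + 6 * n\<^sup>2 + 2 * n + 16 * q * (n + 3) \<le> 51 * q + (\<Sum>j<n. 16 * q * (j div q + 3))"
proof -
  have "6 * n\<^sup>2 + 2 * n + 16 * q * n \<le> (\<Sum>j<n. 16 * q * (j div q + 3))"
  proof (induction n)
    case (Suc n)
    \<comment> \<open>Hence the new summand is at least \<open>16 * n + 32 * q\<close>, while the
      left side grows by \<open>12 * n + 8 + 16 * q\<close>.\<close>
    have "n \<le> q * (n div q) + q"
      using mod_less_divisor[OF assms, of n] mult_div_mod_eq[of q n] by linarith
    moreover have "6 * (Suc n)\<^sup>2 = 6 * n\<^sup>2 + 12 * n + 6"
      by (simp add: power2_eq_square)
    ultimately show ?case
      using Suc assms by (simp add: algebra_simps)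
  qed simp
  then show ?thesis
    using assms by (simp add: algebra_simps)
qed

lemma steps_RecEIS_if_loop:
  assumes "q > 0"
    and "steps (RecEIS_loop tie A (degree_list A vs) S) + (\<Sum>j<length vs. 16 * q * (j div q + 3))
      \<le> 51 * q * length (outputs (RecEIS_loop tie A (degree_list A vs) S)) + 1 + 5 * (length vs)\<^sup>2"
  shows "steps (RecEIS tie A vs S) + 16 * q * (length vs + 3)
    \<le> 51 * q * length (outputs (RecEIS tie A vs S))"
  using assms(2) potential_bound[OF assms(1), of "length vs"]
  by (simp add: RecEIS_unfold algebra_simps power2_eq_square)

text \<open>The call made with \<open>k\<close> vertices left contributes the summand for
  \<open>j = k - 1\<close>. The term \<open>5 * (length vs)\<^sup>2\<close> absorbs the linear costs
  of all iterations.\<close>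

lemma steps_RecEIS_loop:
  assumes irrefl: "\<And>v. {v} \<notin> E" and A: "A = adjacency_matrix E" and "q > 0"
  shows "distinct vs \<Longrightarrow> clique_free q (set vs) E \<Longrightarrow>
    steps (RecEIS_loop tie A (degree_list A vs) S) + (\<Sum>j<length vs. 16 * q * (j div q + 3))
      \<le> 51 * q * length (outputs (RecEIS_loop tie A (degree_list A vs) S)) + 1 + 5 * (length vs)\<^sup>2"
proof (induction "length vs" arbitrary: vs S rule: less_induct)
  case less
  show ?case
  proof (cases "vs = []")
    case True
    then show ?thesis
      by simp
  next
    case False
    have sym: "A u v = A v u" for u v
      by (simp add: A adjacency_matrix_def insert_commute)
    obtain v where v: "v \<in> set vs" "\<And>u. u \<in> set vs \<Longrightarrow> degree A vs v \<le> degree A vs u" and out: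
      "outputs (RecEIS_loop tie A (degree_list A vs) S) =
       outputs (RecEIS tie A (filter (\<lambda>u. u \<noteq> v \<and> \<not> A v u) vs) (v # S)) @
       outputs (RecEIS_loop tie A (degree_list A (filter (\<lambda>u. u \<noteq> v) vs)) S)" and steps:
      "steps (RecEIS_loop tie A (degree_list A vs) S) =
       3 * length vs + 2 +
       steps (RecEIS tie A (filter (\<lambda>u. u \<noteq> v \<and> \<not> A v u) vs) (v # S)) +
       steps (RecEIS_loop tie A (degree_list A (filter (\<lambda>u. u \<noteq> v) vs)) S)"
      by (rule RecEIS_loop_unfold[OF sym less.prems(1) False, where tie = tie and S = S]) (rule that)
    define N where "N = filter (\<lambda>u. u \<noteq> v \<and> \<not> A v u) vs"
    define D where "D = filter (\<lambda>u. u \<noteq> v) vs"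
    have lengths: "length N < length vs" "length D < length vs"
      unfolding N_def D_def using v by (auto intro!: length_filter_less)
    have subsets: "set N \<subseteq> set vs" "set D \<subseteq> set vs"
      by (auto simp: N_def D_def)
    have "set D = set vs - {v}"
      by (auto simp: D_def)
    then have "length D = length vs - 1"
      using less.prems(1) v(1) by (simp add: D_def flip: distinct_card)
    then have len: "length vs = Suc (length D)"
      using lengths by simp
    have "steps (RecEIS tie A N (v # S)) + 16 * q * (length N + 3)
        \<le> 51 * q * length (outputs (RecEIS tie A N (v # S)))"
      using less.prems clique_free_subset[OF _ subsets(1)]
      by (intro steps_RecEIS_if_loop less.hyps lengths \<open>q > 0\<close>) (auto simp: N_def)
    \<comment> \<open>As \<open>length D\<close> is \<open>length vs - 1\<close>, the left side is
      the last summand, paid by the potential left over from the call on \<open>N\<close>.\<close>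
    moreover have "16 * q * (length D div q + 3) \<le> 16 * q * (length N + 3)"
      using length_outside_nbhd_ge[OF irrefl A less.prems(1) v(1) less.prems(2) v(2)] len
      by (simp add: N_def)
    moreover have "steps (RecEIS_loop tie A (degree_list A D) S)
        + (\<Sum>j<length D. 16 * q * (j div q + 3))
      \<le> 51 * q * length (outputs (RecEIS_loop tie A (degree_list A D) S)) + 1 + 5 * (length D)\<^sup>2"
      using less.prems clique_free_subset[OF _ subsets(2)]
      by (intro less.hyps lengths) (auto simp: D_def)
    moreover have "3 * length vs + 2 + 5 * (length D)\<^sup>2 \<le> 5 * (length vs)\<^sup>2"
      by (simp add: len power2_eq_square)
    ultimately show ?thesis
      unfolding out steps N_def[symmetric] D_def[symmetric]
      unfolding length_append distrib_left[of "51 * q"] by (simp only: len sum.lessThan_Suc)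
  qed
qed

text \<open>The witness is \<open>C = 51\<close>, independent of \<open>q\<close>; since
  \<open>EIS\<close> does not receive \<open>q\<close>, the bound holds for every admissible
  \<open>q\<close> at once.\<close>

theorem theorem8:
  fixes tie :: tie_rule
  shows "\<exists>C::nat. \<forall>(q::nat) (n::nat) (E::nat set set).
    simple_graph {..<n} E \<and> clique_free q {..<n} E \<longrightarrow>
      (let run = EIS tie n (adjacency_matrix E);
           sols = map set (outputs run)
       in distinct sols \<and>
          set sols = independent_sets {..<n} E \<and>
          steps run \<le> C * q * card (independent_sets {..<n} E))"
proof -
  have *: "distinct (map set (outputs (EIS tie n A))) \<and>
      set (map set (outputs (EIS tie n A))) = independent_sets {..<n} E \<and>
      steps (EIS tie n A) \<le> 51 * q * card (independent_sets {..<n} E)"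
    if "simple_graph {..<n} E" "clique_free q {..<n} E" and A: "A = adjacency_matrix E"
    for q n E A
  proof -
    have irrefl: "{v} \<notin> E" for v
      using that(1) by (force simp: simple_graph_def)
    \<comment> \<open>The empty set is a clique of size 0.\<close>
    have "q > 0"
      using that(2) by (cases "q = 0") (auto simp: clique_free_def clique_def)
    let ?vs = "rev [0..<n]"
    have vs: "distinct ?vs" "set ?vs = {..<n}" "length ?vs = n"
      by auto
    have out: "outputs (EIS tie n A) = outputs (RecEIS tie A ?vs [])"
      and steps: "steps (EIS tie n A) = n + 1 + steps (RecEIS tie A ?vs [])"
      by (simp_all add: EIS_def)
    have "enumerates (outputs (RecEIS tie A ?vs [])) [] (independent_sets (set ?vs) E)"
      using vs(1) by (intro RecEIS_enumerates_if_loop RecEIS_loop_enumerates irrefl A) auto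
    then have enum: "distinct (map set (outputs (EIS tie n A)))"
        "set (map set (outputs (EIS tie n A))) = independent_sets {..<n} E"
      unfolding enumerates_def out vs(2) by simp_all
    then have card: "card (independent_sets {..<n} E) = length (outputs (EIS tie n A))"
      by (metis distinct_card length_map)
    have "steps (RecEIS tie A ?vs []) + 16 * q * (length ?vs + 3)
        \<le> 51 * q * length (outputs (RecEIS tie A ?vs []))"
      using vs that(2) \<open>q > 0\<close>
      by (intro steps_RecEIS_if_loop steps_RecEIS_loop[OF irrefl A]) auto
    \<comment> \<open>The potential of the root call pays for building the vertex list.\<close>
    moreover have "n + 1 \<le> 16 * q * (n + 3)"
      using mult_le_mono[of 1 "16 * q" "n + 1" "n + 3"] \<open>q > 0\<close> by simp
    ultimately have "steps (EIS tie n A) \<le> 51 * q * card (independent_sets {..<n} E)"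
      unfolding card out steps vs(3) by linarith
    then show ?thesis
      using enum by blast
  qed
  show ?thesis
    unfolding Let_def using * by blast
qed

end
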